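(* Let $(\mathcal F_t)_{t\ge0}$ be a filtration on a probability space $(\Omega,\mathcal F,\mathbb P)$ and let $(X_t)_{t\ge1}$ be an adapted process with $X_t\in[0,1]$ $\mathbb P$-almost surely. Let $p_{t-1}:=\mathbb E_{\mathbb P}[X_t\mid\mathcal F_{t-1}]$ for $t\ge1$. Fix a Borel set (bin) $I\subset[0,1]$ and define $W_t:=\mathbf 1\{p_{t-1}\in I\}$, $N_n(I):=\sum_{t=1}^nW_t$, and, whenever $N_n(I)>0$, $$\widehat x_n(I):=\frac1{N_n(I)}\sum_{t=1}^nW_tX_t,\qquad \widehat p_n(I):=\frac1{N_n(I)}\sum_{t=1}^nW_tp_{t-1}.$$ Then (whenever $N_n(I)>0$) $$\widehat x_n(I)-\widehat p_n(I)=\frac{\sum_{t=1}^nW_t(X_t-p_{t-1})}{\sum_{t=1}^nW_t},$$ and, on the event $\{N_n(I)\to\infty\}$, $$\widehat x_n(I)-\widehat p_n(I)\longrightarrow0\quad\text{almost surely}.$$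
   Context: "On the event $E$, $Y_n\to0$ almost surely" means $\mathbb P(E\cap\{Y_n\not\to0\})=0$. *)

theory Defs
  imports "HOL-Probability.Probability"
begin

text \<open>
  Time runs over \<^typ>\<open>nat\<close>. The forecast \<open>p s\<close> is a version of the conditional expectation of
  \<open>X (s + 1)\<close> given \<open>F s\<close>, so the forecast of \<open>X t\<close> is \<open>p (t - 1)\<close>. The subtraction is harmless
  because \<open>t\<close> ranges over \<open>t \<ge> 1\<close> wherever it occurs.
\<close>

definition bin_hit :: "real set \<Rightarrow> (nat \<Rightarrow> 'a \<Rightarrow> real) \<Rightarrow> nat \<Rightarrow> 'a \<Rightarrow> real" where
  "bin_hit I p t \<omega> = indicator I (p (t - 1) \<omega>)"

definition bin_count :: "real set \<Rightarrow> (nat \<Rightarrow> 'a \<Rightarrow> real) \<Rightarrow> nat \<Rightarrow> 'a \<Rightarrow> real" where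
  "bin_count I p n \<omega> = (\<Sum>t=1..n. bin_hit I p t \<omega>)"

text \<open>
  The two bin averages are meaningful only where the count is positive; elsewhere division by zero
  gives them the value 0.
\<close>

definition bin_mean_outcome ::
    "real set \<Rightarrow> (nat \<Rightarrow> 'a \<Rightarrow> real) \<Rightarrow> (nat \<Rightarrow> 'a \<Rightarrow> real) \<Rightarrow> nat \<Rightarrow> 'a \<Rightarrow> real" where
  "bin_mean_outcome I p X n \<omega> =
    1 / bin_count I p n \<omega> * (\<Sum>t=1..n. bin_hit I p t \<omega> * X t \<omega>)"

definition bin_mean_forecast :: "real set \<Rightarrow> (nat \<Rightarrow> 'a \<Rightarrow> real) \<Rightarrow> nat \<Rightarrow> 'a \<Rightarrow> real" where
  "bin_mean_forecast I p n \<omega> =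
    1 / bin_count I p n \<omega> * (\<Sum>t=1..n. bin_hit I p t \<omega> * p (t - 1) \<omega>)"

end

theory Submission
  imports Defs
begin

text \<open>
  The sequence \<open>X t - p (t - 1)\<close>, switched on only at the hits of the bin, is a bounded
  martingale difference sequence \<open>D\<close> whose size is controlled by the predictable indicator \<open>W\<close>
  of a hit. The claim is thus a strong law for \<open>S n = (\<Sum>k<n. D k)\<close> on the random clock
  \<open>N n = (\<Sum>k<n. W k)\<close>, on the event that the clock diverges.

  The proof uses the exponential supermartingales \<open>Q n = exp (l * S n - 2 * l\<^sup>2 * N n)\<close> for small
  \<open>l\<close> of either sign. The compensator \<open>2 * l\<^sup>2 * N n\<close> is deliberately twice as large as needed,
  so that \<open>Q\<close> loses in mean at least a fixed proportion \<open>1 - exp (- l\<^sup>2)\<close> of its value at every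
  hit (\<open>exp_supermartingale_step\<close>). As \<open>Q\<close> is nonnegative and starts at 1, the total loss is
  bounded; hence \<open>\<Sum>n. W n * Q n\<close> has finite expectation, and \<open>W n * Q n\<close> tends to 0 almost
  surely (\<open>exp_supermartingale_hits_tendsto_0\<close>). Since \<open>Q\<close> is constant between hits, on the event
  \<open>N n \<rightarrow> \<infinity>\<close> all late values of \<open>Q\<close> are below 1, that is, \<open>l * S n < 2 * l\<^sup>2 * N n\<close>. Applying this
  to \<open>l = a\<close> and \<open>l = - a\<close> gives \<open>\<bar>S n\<bar> < 2 * a * N n\<close> eventually, for arbitrarily small \<open>a\<close>.
  No stopping times and no martingale convergence theorem are needed.
\<close>

section \<open>A quadratic bound on the exponential\<close>

lemma exp_le_1_plus_x_plus_square:
  fixes x :: real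
  assumes "\<bar>x\<bar> \<le> 1"
  shows "exp x \<le> 1 + x + x\<^sup>2"
proof (cases "x \<ge> 0")
  case True
  then show ?thesis using assms exp_bound[of x] by simp
next
  case False
  define y where "y = - x"
  have y: "0 < y" "y \<le> 1" using False assms by (auto simp: y_def)
  have "1 + y + y\<^sup>2 / 2 \<le> exp y"
    using exp_lower_Taylor_quadratic[of y] y by simp
  moreover have "1 \<le> (1 - y + y\<^sup>2) * (1 + y + y\<^sup>2 / 2)"
  proof -
    have "(1 - y + y\<^sup>2) * (1 + y + y\<^sup>2 / 2) = 1 + y\<^sup>2 / 2 + y^3 / 2 + y^4 / 2"
      by (simp add: field_simps power2_eq_square power3_eq_cube power4_eq_xxxx)
    then show ?thesis using y by simp
  qed
  moreover have "0 \<le> 1 - y + y\<^sup>2" using y by simp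
  ultimately have "1 \<le> (1 - y + y\<^sup>2) * exp y"
    by (meson mult_left_mono order_trans)
  then have "exp (- y) \<le> 1 - y + y\<^sup>2"
    by (simp add: exp_minus field_simps)
  then show ?thesis by (simp add: y_def)
qed

section \<open>Exponential supermartingales on a random clock\<close>

text \<open>
  A sequence of bounded martingale differences \<open>D\<close> with a predictable switch \<open>W\<close>: \<open>D k\<close> is
  revealed at time \<open>k + 1\<close>, while \<open>W k\<close>, which is 0 or 1 and dominates \<open>\<bar>D k\<bar>\<close>, is
  already known at time \<open>k\<close>. The partial sums of \<open>D\<close> and \<open>W\<close> up to time \<open>n\<close> are \<open>S n\<close> and \<open>N n\<close>.
\<close>

locale switched_martingale_differences = prob_space M for M :: "'a measure" +
  fixes F :: "nat \<Rightarrow> 'a measure"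
    and D W :: "nat \<Rightarrow> 'a \<Rightarrow> real"
  assumes subalg: "subalgebra M (F t)"
    and F_mono: "s \<le> t \<Longrightarrow> sets (F s) \<subseteq> sets (F t)"
    and D_measurable: "D k \<in> borel_measurable (F (Suc k))"
    and W_measurable: "W k \<in> borel_measurable (F k)"
    and W_01: "W k \<omega> \<in> {0, 1}"
    and D_le_W: "AE \<omega> in M. \<bar>D k \<omega>\<bar> \<le> W k \<omega>"
    and D_cond_exp: "AE \<omega> in M. real_cond_exp M (F k) (D k) \<omega> = 0"
begin

definition S :: "nat \<Rightarrow> 'a \<Rightarrow> real" where "S n \<omega> = (\<Sum>k<n. D k \<omega>)"

definition N :: "nat \<Rightarrow> 'a \<Rightarrow> real" where "N n \<omega> = (\<Sum>k<n. W k \<omega>)"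

text \<open>
  The exponential supermartingale with parameter \<open>l\<close>. Compensating by \<open>l\<^sup>2 * N n\<close> would already
  give a supermartingale for \<open>\<bar>l\<bar> \<le> 1\<close>; the factor 2 makes it decay at every hit.
\<close>

definition Q :: "real \<Rightarrow> nat \<Rightarrow> 'a \<Rightarrow> real" where
  "Q l n \<omega> = exp (l * S n \<omega> - 2 * l\<^sup>2 * N n \<omega>)"

lemma S_Suc: "S (Suc n) \<omega> = S n \<omega> + D n \<omega>"
  and N_Suc: "N (Suc n) \<omega> = N n \<omega> + W n \<omega>"
  by (simp_all add: S_def N_def)

lemma W_nonneg: "0 \<le> W k \<omega>" and W_le_1: "W k \<omega> \<le> 1"
  using W_01[of k \<omega>] by auto

lemma N_nonneg: "0 \<le> N n \<omega>"
  by (simp add: N_def sum_nonneg W_nonneg)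

lemma measurable_F_mono:
  assumes "f \<in> borel_measurable (F s)" "s \<le> t"
  shows "(f :: 'a \<Rightarrow> real) \<in> borel_measurable (F t)"
proof -
  have "subalgebra (F t) (F s)"
    using subalg[of s] subalg[of t] F_mono[OF assms(2)] by (simp add: subalgebra_def)
  then show ?thesis using assms(1) by (rule measurable_from_subalg)
qed

lemma Q_measurable: "Q l n \<in> borel_measurable (F n)"
proof -
  have [measurable]: "D k \<in> borel_measurable (F n)" "W k \<in> borel_measurable (F n)"
    if "k < n" for k
    using that measurable_F_mono[OF D_measurable] measurable_F_mono[OF W_measurable] by auto
  show ?thesis unfolding Q_def[abs_def] S_def N_def by measurable
qed

lemma measurable_M [measurable]:
  "D n \<in> borel_measurable M" "W n \<in> borel_measurable M" "Q l n \<in> borel_measurable M"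
  using measurable_from_subalg[OF subalg] D_measurable W_measurable Q_measurable by blast+

lemma abs_S_le: "AE \<omega> in M. \<bar>S n \<omega>\<bar> \<le> real n"
proof -
  have "AE \<omega> in M. \<forall>k. \<bar>D k \<omega>\<bar> \<le> W k \<omega>"
    using D_le_W by (simp add: AE_all_countable)
  then show ?thesis
  proof eventually_elim
    case (elim \<omega>)
    have "\<bar>S n \<omega>\<bar> \<le> (\<Sum>k<n. \<bar>D k \<omega>\<bar>)" unfolding S_def by (rule sum_abs)
    also have "\<dots> \<le> (\<Sum>k<n. 1)"
      using elim W_le_1 by (intro sum_mono) (meson order_trans)
    finally show ?case by simp
  qed
qed

lemma Q_bounded: "AE \<omega> in M. Q l n \<omega> \<le> exp (\<bar>l\<bar> * real n)"
  using abs_S_le[of n]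
proof eventually_elim
  case (elim \<omega>)
  have "l * S n \<omega> \<le> \<bar>l\<bar> * \<bar>S n \<omega>\<bar>" by (simp add: abs_mult[symmetric])
  also have "\<dots> \<le> \<bar>l\<bar> * real n" using elim by (intro mult_left_mono) auto
  finally show ?case using N_nonneg[of n \<omega>] by (simp add: Q_def) (smt (verit) mult_nonneg_nonneg zero_le_power2)
qed

lemma integrable_if_le_Q:
  assumes "g \<in> borel_measurable M" "AE \<omega> in M. \<bar>g \<omega>\<bar> \<le> Q l n \<omega>"
  shows "integrable M g"
proof (rule integrable_const_bound[where B = "exp (\<bar>l\<bar> * real n)"])
  show "AE \<omega> in M. norm (g \<omega>) \<le> exp (\<bar>l\<bar> * real n)"
    using assms(2) Q_bounded[of l n] by eventually_elim simp
qed (rule assms(1))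

lemma integrable_Q: "integrable M (Q l n)"
  by (rule integrable_if_le_Q[where l = l and n = n]) (auto simp: Q_def)

lemma integrable_WQ: "integrable M (\<lambda>\<omega>. W n \<omega> * Q l n \<omega>)"
proof (rule integrable_if_le_Q[where l = l and n = n])
  show "AE \<omega> in M. \<bar>W n \<omega> * Q l n \<omega>\<bar> \<le> Q l n \<omega>"
    by (simp add: abs_mult W_nonneg W_le_1 Q_def mult_left_le_one_le)
qed measurable

text \<open>
  One step: a second-order expansion of \<open>exp (l * D n)\<close>, whose linear term has conditional mean 0.
\<close>

lemma exp_supermartingale_step:
  assumes l: "\<bar>l\<bar> \<le> 1"
  shows "expectation (Q l (Suc n)) \<le>
    expectation (Q l n) - (1 - exp (- l\<^sup>2)) * expectation (\<lambda>\<omega>. W n \<omega> * Q l n \<omega>)"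
proof -
  \<comment> \<open>The factor of \<open>Q l (Suc n)\<close> that is known at time \<open>n\<close>; the other factor is \<open>exp (l * D n)\<close>.\<close>
  define H where "H \<omega> = Q l n \<omega> * exp (- 2 * l\<^sup>2 * W n \<omega>)" for \<omega>
  note [measurable] = Q_measurable W_measurable
  have H_F: "H \<in> borel_measurable (F n)" unfolding H_def[abs_def] by measurable
  have H_M[measurable]: "H \<in> borel_measurable M"
    using measurable_from_subalg[OF subalg H_F] .
  have H0: "0 \<le> H \<omega>" for \<omega> by (simp add: H_def Q_def)
  have HQ: "H \<omega> \<le> Q l n \<omega>" for \<omega>
    using W_nonneg[of n \<omega>] by (simp add: H_def Q_def)
  have int_HD: "integrable M (\<lambda>\<omega>. H \<omega> * D n \<omega>)"
  proof (rule integrable_if_le_Q[where l = l and n = n])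
    show "AE \<omega> in M. \<bar>H \<omega> * D n \<omega>\<bar> \<le> Q l n \<omega>"
      using D_le_W[of n]
    proof eventually_elim
      case (elim \<omega>)
      then have "\<bar>D n \<omega>\<bar> \<le> 1" using W_le_1[of n \<omega>] by simp
      then have "H \<omega> * \<bar>D n \<omega>\<bar> \<le> H \<omega> * 1" using H0 by (intro mult_left_mono)
      then show ?case using HQ[of \<omega>] H0[of \<omega>] by (simp add: abs_mult)
    qed
  qed measurable
  interpret sub: finite_measure_subalgebra M "F n"
    by unfold_locales (rule subalg)
  have HD: "expectation (\<lambda>\<omega>. H \<omega> * D n \<omega>) = 0"
  proof -
    have "expectation (\<lambda>\<omega>. H \<omega> * D n \<omega>) =
        expectation (\<lambda>\<omega>. H \<omega> * real_cond_exp M (F n) (D n) \<omega>)"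
      by (rule sub.real_cond_exp_intg(2)[symmetric]) (use int_HD H_F in auto)
    also have "\<dots> = expectation (\<lambda>\<omega>. 0)"
      using D_cond_exp[of n] by (intro integral_cong_AE) auto
    finally show ?thesis by simp
  qed
  have "AE \<omega> in M. Q l (Suc n) \<omega> \<le>
      Q l n \<omega> - (1 - exp (- l\<^sup>2)) * (W n \<omega> * Q l n \<omega>) + l * (H \<omega> * D n \<omega>)"
    using D_le_W[of n]
  proof eventually_elim
    case (elim \<omega>)
    have D1: "\<bar>D n \<omega>\<bar> \<le> 1" using elim W_le_1[of n \<omega>] by simp
    have "\<bar>l * D n \<omega>\<bar> \<le> 1"
      using l D1 by (simp add: abs_mult mult_le_one)
    then have "exp (l * D n \<omega>) \<le> 1 + l * D n \<omega> + (l * D n \<omega>)\<^sup>2"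
      by (rule exp_le_1_plus_x_plus_square)
    also have "(l * D n \<omega>)\<^sup>2 \<le> l\<^sup>2 * W n \<omega>"
    proof -
      have "(D n \<omega>)\<^sup>2 \<le> W n \<omega>"
        using elim W_01[of n \<omega>] by (auto simp: abs_square_le_1)
      then show ?thesis by (simp add: power_mult_distrib mult_left_mono)
    qed
    finally have e: "exp (l * D n \<omega>) \<le> 1 + l * D n \<omega> + l\<^sup>2 * W n \<omega>" by simp
    have "Q l (Suc n) \<omega> = H \<omega> * exp (l * D n \<omega>)"
      by (simp add: Q_def H_def S_Suc N_Suc exp_add[symmetric] algebra_simps)
    also have "\<dots> \<le> H \<omega> * (1 + l * D n \<omega> + l\<^sup>2 * W n \<omega>)"
      using e H0 by (intro mult_left_mono)
    also have "\<dots> = H \<omega> * (1 + l\<^sup>2 * W n \<omega>) + l * (H \<omega> * D n \<omega>)"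
      by (simp add: algebra_simps)
    also have "H \<omega> * (1 + l\<^sup>2 * W n \<omega>) \<le> Q l n \<omega> - (1 - exp (- l\<^sup>2)) * (W n \<omega> * Q l n \<omega>)"
    proof (cases "W n \<omega> = 0")
      case True
      then show ?thesis by (simp add: H_def)
    next
      case False
      then have W1: "W n \<omega> = 1" using W_01[of n \<omega>] by auto
      have "exp (- 2 * l\<^sup>2) * (1 + l\<^sup>2) \<le> exp (- 2 * l\<^sup>2) * exp (l\<^sup>2)"
        by (intro mult_left_mono exp_ge_add_one_self) simp
      also have "\<dots> = exp (- l\<^sup>2)" by (simp add: exp_add[symmetric])
      finally have "Q l n \<omega> * (exp (- 2 * l\<^sup>2) * (1 + l\<^sup>2)) \<le> Q l n \<omega> * exp (- l\<^sup>2)"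
        by (intro mult_left_mono) (simp_all add: Q_def)
      then show ?thesis by (simp add: H_def W1 algebra_simps)
    qed
    finally show ?case by simp
  qed
  then have "expectation (Q l (Suc n)) \<le> expectation (\<lambda>\<omega>.
      Q l n \<omega> - (1 - exp (- l\<^sup>2)) * (W n \<omega> * Q l n \<omega>) + l * (H \<omega> * D n \<omega>))"
    by (intro integral_mono_AE integrable_Q Bochner_Integration.integrable_add
        Bochner_Integration.integrable_diff integrable_mult_right integrable_WQ int_HD)
  also have "\<dots> = expectation (Q l n)
      - (1 - exp (- l\<^sup>2)) * expectation (\<lambda>\<omega>. W n \<omega> * Q l n \<omega>)"
    using integrable_Q integrable_WQ int_HD HD by simp
  finally show ?thesis .
qed

lemma exp_supermartingale_hits_tendsto_0:
  assumes l: "\<bar>l\<bar> \<le> 1" "l \<noteq> 0"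
  shows "AE \<omega> in M. (\<lambda>n. W n \<omega> * Q l n \<omega>) \<longlonglongrightarrow> 0"
proof -
  define c where "c = 1 - exp (- l\<^sup>2)"
  define e where "e n = expectation (\<lambda>\<omega>. W n \<omega> * Q l n \<omega>)" for n
  have c: "c > 0" using l by (simp add: c_def)
  have WQ0: "0 \<le> W n \<omega> * Q l n \<omega>" for n \<omega> by (simp add: W_nonneg Q_def)
  have e0: "0 \<le> e n" for n unfolding e_def by (intro integral_nonneg_AE AE_I2 WQ0)
  have "expectation (Q l n) + c * (\<Sum>k<n. e k) \<le> 1" for n
  proof (induction n)
    case 0
    then show ?case by (simp add: Q_def S_def N_def prob_space)
  next
    case (Suc n)
    then show ?case
      using exp_supermartingale_step[OF l(1), of n] by (simp add: c_def e_def algebra_simps)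
  qed
  moreover have "0 \<le> expectation (Q l n)" for n
    by (intro integral_nonneg_AE) (simp add: Q_def)
  ultimately have "c * (\<Sum>k<n. e k) \<le> 1" for n by (smt (verit))
  then have "(\<Sum>k<n. e k) \<le> 1 / c" for n
    using c by (simp add: field_simps)
  then have "summable e" by (intro bounded_imp_summable[of _ "1 / c"] e0) (metis lessThan_Suc_atMost)
  have "(\<integral>\<^sup>+\<omega>. (\<Sum>n. ennreal (W n \<omega> * Q l n \<omega>)) \<partial>M) = (\<Sum>n. ennreal (e n))"
    by (subst nn_integral_suminf)
       (auto simp: e_def WQ0 nn_integral_eq_integral[OF integrable_WQ])
  also have "\<dots> \<noteq> \<infinity>"
    using \<open>summable e\<close> e0 by (simp add: suminf_ennreal2)
  finally have "AE \<omega> in M. (\<Sum>n. ennreal (W n \<omega> * Q l n \<omega>)) \<noteq> \<infinity>"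
    by (intro nn_integral_PInf_AE) measurable
  then show ?thesis
  proof eventually_elim
    case (elim \<omega>)
    then have "summable (\<lambda>n. W n \<omega> * Q l n \<omega>)"
      using WQ0 by (intro summable_suminf_not_top) auto
    then show ?case by (rule summable_LIMSEQ_zero)
  qed
qed

section \<open>The strong law on the random clock\<close>

text \<open>
  Between two hits neither \<open>S\<close> nor \<open>N\<close> moves, so the value of \<open>Q\<close> at time \<open>n\<close> is still its value
  at the next hit, and smallness at the hits is smallness throughout.
\<close>

lemma eventually_Q_less_1:
  assumes lim: "(\<lambda>n. W n \<omega> * Q l n \<omega>) \<longlonglongrightarrow> 0"
    and D: "\<And>k. \<bar>D k \<omega>\<bar> \<le> W k \<omega>"
    and N: "filterlim (\<lambda>n. N n \<omega>) at_top sequentially"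
  shows "eventually (\<lambda>n. Q l n \<omega> < 1) sequentially"
proof -
  obtain n0 where n0: "\<And>n. n \<ge> n0 \<Longrightarrow> W n \<omega> * Q l n \<omega> < 1"
    using order_tendstoD(2)[OF lim, of 1] by (auto simp: eventually_sequentially)
  have "Q l n \<omega> < 1" if n: "n \<ge> n0" for n
  proof -
    have ex: "\<exists>m\<ge>n. W m \<omega> = 1"
    proof (rule ccontr)
      assume "\<not> ?thesis"
      then have W0: "W m \<omega> = 0" if "m \<ge> n" for m using that W_01[of m \<omega>] by auto
      have "N m \<omega> = N n \<omega>" if "m \<ge> n" for m
        using that by (induction rule: dec_induct) (simp_all add: N_Suc W0)
      moreover have "eventually (\<lambda>m. N m \<omega> > N n \<omega>) sequentially"
        using N by (simp add: filterlim_at_top_dense)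
      ultimately show False
        by (metis eventually_sequentially less_irrefl linorder_linear)
    qed
    \<comment> \<open>The next hit after time \<open>n\<close>, or \<open>n\<close> itself if that is one.\<close>
    define m where "m = (LEAST m. m \<ge> n \<and> W m \<omega> = 1)"
    have m: "m \<ge> n" "W m \<omega> = 1"
      using LeastI_ex[of "\<lambda>m. m \<ge> n \<and> W m \<omega> = 1"] ex by (auto simp: m_def)
    have W0: "W k \<omega> = 0" if "n \<le> k" "k < m" for k
      using that not_less_Least[of k "\<lambda>m. m \<ge> n \<and> W m \<omega> = 1"] W_01[of k \<omega>]
      by (auto simp: m_def)
    have D0: "D k \<omega> = 0" if "n \<le> k" "k < m" for k
      using D[of k] W0[OF that] by simp
    have "S m \<omega> = S n \<omega> \<and> N m \<omega> = N n \<omega>"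
      using m(1) W0 D0
    proof (induction rule: dec_induct)
      case (step k)
      then show ?case by (simp add: S_Suc N_Suc)
    qed simp
    then have "Q l n \<omega> = W m \<omega> * Q l m \<omega>" by (simp add: Q_def m)
    also have "\<dots> < 1" using m n by (intro n0) simp
    finally show ?thesis .
  qed
  then show ?thesis by (auto simp: eventually_sequentially)
qed

theorem strong_law_on_random_clock:
  "AE \<omega> in M. filterlim (\<lambda>n. N n \<omega>) at_top sequentially \<longrightarrow> (\<lambda>n. S n \<omega> / N n \<omega>) \<longlonglongrightarrow> 0"
proof -
  define a :: "nat \<Rightarrow> real" where "a j = 1 / real (Suc j)" for j
  have a: "0 < a j" "a j \<le> 1" for j by (simp_all add: a_def)
  have "AE \<omega> in M. \<forall>j. (\<lambda>n. W n \<omega> * Q (a j) n \<omega>) \<longlonglongrightarrow> 0"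
    unfolding AE_all_countable
  proof
    show "AE \<omega> in M. (\<lambda>n. W n \<omega> * Q (a j) n \<omega>) \<longlonglongrightarrow> 0" for j
      using a[of j] by (intro exp_supermartingale_hits_tendsto_0) auto
  qed
  moreover have "AE \<omega> in M. \<forall>j. (\<lambda>n. W n \<omega> * Q (- a j) n \<omega>) \<longlonglongrightarrow> 0"
    unfolding AE_all_countable
  proof
    show "AE \<omega> in M. (\<lambda>n. W n \<omega> * Q (- a j) n \<omega>) \<longlonglongrightarrow> 0" for j
      using a[of j] by (intro exp_supermartingale_hits_tendsto_0) auto
  qed
  moreover have "AE \<omega> in M. \<forall>k. \<bar>D k \<omega>\<bar> \<le> W k \<omega>"
    using D_le_W by (simp add: AE_all_countable)
  ultimately show ?thesis
  proof eventually_elim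
    case (elim \<omega>)
    show ?case
    proof (intro impI tendstoI)
      assume N: "filterlim (\<lambda>n. N n \<omega>) at_top sequentially"
      fix e :: real assume "e > 0"
      then obtain j where j: "1 / real (Suc j) < e / 2"
        using nat_approx_posE[of "e / 2"] by auto
      have "eventually (\<lambda>n. Q (a j) n \<omega> < 1) sequentially"
        "eventually (\<lambda>n. Q (- a j) n \<omega> < 1) sequentially"
        using elim N by (auto intro!: eventually_Q_less_1)
      moreover have "eventually (\<lambda>n. N n \<omega> > 0) sequentially"
        using N by (simp add: filterlim_at_top_dense)
      ultimately show "eventually (\<lambda>n. dist (S n \<omega> / N n \<omega>) 0 < e) sequentially"
      proof eventually_elim
        case (elim n)
        have "a j * S n \<omega> < a j * (2 * a j * N n \<omega>)" "a j * - S n \<omega> < a j * (2 * a j * N n \<omega>)"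
          using elim by (simp_all add: Q_def power2_eq_square algebra_simps)
        then have "\<bar>S n \<omega>\<bar> < 2 * a j * N n \<omega>"
          using a(1)[of j] by (simp only: mult_less_cancel_left_pos abs_less_iff)
        also have "\<dots> < e * N n \<omega>"
          using j elim by (intro mult_strict_right_mono) (auto simp: a_def)
        finally show ?case using elim by (simp add: dist_real_def field_simps)
      qed
    qed
  qed
qed

end

section \<open>Averages over a bin\<close>

theorem proposition12:
  fixes M :: "'a measure"
    and F :: "nat \<Rightarrow> 'a measure"
    and X p :: "nat \<Rightarrow> 'a \<Rightarrow> real"
    and I :: "real set"
  assumes "prob_space M"
    and "filtration (space M) F"
    and "\<And>t. subalgebra M (F t)"
    and "\<And>t. t \<ge> 1 \<Longrightarrow> X t \<in> borel_measurable (F t)"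
    and "\<And>t. t \<ge> 1 \<Longrightarrow> AE \<omega> in M. X t \<omega> \<in> {0..1}"
    and "\<And>t. t \<ge> 1 \<Longrightarrow> p (t - 1) \<in> borel_measurable (F (t - 1))"
    and "\<And>t. t \<ge> 1 \<Longrightarrow> AE \<omega> in M. p (t - 1) \<omega> = real_cond_exp M (F (t - 1)) (X t) \<omega>"
    and "I \<in> sets borel"
    and "I \<subseteq> {0..1}"
  shows "(\<forall>n. \<forall>\<omega>\<in>space M. bin_count I p n \<omega> > 0 \<longrightarrow>
            bin_mean_outcome I p X n \<omega> - bin_mean_forecast I p n \<omega> =
              (\<Sum>t=1..n. bin_hit I p t \<omega> * (X t \<omega> - p (t - 1) \<omega>)) / (\<Sum>t=1..n. bin_hit I p t \<omega>))
       \<and> {\<omega> \<in> space M. filterlim (\<lambda>n. bin_count I p n \<omega>) at_top sequentially} \<inter>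
         {\<omega> \<in> space M. \<not> (\<lambda>n. bin_mean_outcome I p X n \<omega> - bin_mean_forecast I p n \<omega>) \<longlonglongrightarrow> 0}
           \<in> null_sets M"
proof -
  interpret prob_space M by fact
  note sub = \<open>\<And>t. subalgebra M (F t)\<close>
  \<comment> \<open>Shifting time by one makes the indices start at 0 and removes the subtraction.\<close>
  define W where "W k \<omega> = (indicator I (p k \<omega>) :: real)" for k \<omega>
  define D where "D k \<omega> = W k \<omega> * (X (Suc k) \<omega> - p k \<omega>)" for k \<omega>
  have mono: "sets (F s) \<subseteq> sets (F t)" if "s \<le> t" for s t
    using \<open>filtration (space M) F\<close> that by (simp add: filtration_def)
  have p_F: "p k \<in> borel_measurable (F k)" for k
    using assms(6)[of "Suc k"] by simp
  have X_F: "X (Suc k) \<in> borel_measurable (F (Suc k))" for k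
    using assms(4)[of "Suc k"] by simp
  have subF: "subalgebra (F (Suc k)) (F k)" for k
    using sub[of k] sub[of "Suc k"] mono[of k "Suc k"] by (simp add: subalgebra_def)
  have p_F_Suc: "p k \<in> borel_measurable (F (Suc k))" for k
    by (rule measurable_from_subalg[OF subF p_F])
  have p_M [measurable]: "p k \<in> borel_measurable M" for k
    by (rule measurable_from_subalg[OF sub p_F])
  have X_M [measurable]: "X (Suc k) \<in> borel_measurable M" for k
    by (rule measurable_from_subalg[OF sub X_F])
  note [measurable] = \<open>I \<in> sets borel\<close>
  have X01: "AE \<omega> in M. X (Suc k) \<omega> \<in> {0..1}" for k
    using assms(5)[of "Suc k"] by simp
  have W_F: "W k \<in> borel_measurable (F k)" for k
    using p_F[of k] unfolding W_def by measurable
  have int_X: "integrable M (X (Suc k))" for k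
    by (rule integrable_const_bound[where B = 1]) (use X01[of k] in auto)
  have D_le_W: "AE \<omega> in M. \<bar>D k \<omega>\<bar> \<le> W k \<omega>" for k
    using X01[of k]
  proof eventually_elim
    case (elim \<omega>)
    \<comment> \<open>At a hit the forecast lies in \<open>I\<close>, hence in the unit interval, without exception.\<close>
    have "p k \<omega> \<in> {0..1}" if "p k \<omega> \<in> I" using that \<open>I \<subseteq> {0..1}\<close> by blast
    then show ?case using elim by (auto simp: D_def W_def indicator_def abs_le_iff)
  qed
  have cond_exp_D: "AE \<omega> in M. real_cond_exp M (F k) (D k) \<omega> = 0" for k
  proof -
    interpret fin: finite_measure_subalgebra M "F k" by unfold_locales (rule sub)
    have pX: "AE \<omega> in M. p k \<omega> = real_cond_exp M (F k) (X (Suc k)) \<omega>"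
      using assms(7)[of "Suc k"] by simp
    have int_p: "integrable M (p k)"
      using fin.real_cond_exp_int(1)[OF int_X] pX
      by (subst integrable_cong_AE) auto
    have int_D: "integrable M (D k)"
    proof (rule integrable_const_bound[where B = 1])
      show "AE \<omega> in M. norm (D k \<omega>) \<le> 1"
        using D_le_W[of k] by eventually_elim (auto simp: W_def indicator_def intro: order_trans split: split_of_bool_asm)
      show "D k \<in> borel_measurable M"
        unfolding D_def W_def by measurable
    qed
    have "AE \<omega> in M. real_cond_exp M (F k) (\<lambda>\<omega>. W k \<omega> * (X (Suc k) \<omega> - p k \<omega>)) \<omega> =
        W k \<omega> * real_cond_exp M (F k) (\<lambda>\<omega>. X (Suc k) \<omega> - p k \<omega>) \<omega>"
      by (rule fin.real_cond_exp_mult) (use W_F int_D in \<open>auto simp: D_def[abs_def]\<close>)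
    moreover have "AE \<omega> in M. real_cond_exp M (F k) (\<lambda>\<omega>. X (Suc k) \<omega> - p k \<omega>) \<omega> =
        real_cond_exp M (F k) (X (Suc k)) \<omega> - real_cond_exp M (F k) (p k) \<omega>"
      by (rule fin.real_cond_exp_diff[OF int_X int_p])
    moreover have "AE \<omega> in M. real_cond_exp M (F k) (p k) \<omega> = p k \<omega>"
      by (rule fin.real_cond_exp_F_meas[OF int_p p_F])
    ultimately show ?thesis using pX
      by eventually_elim (simp add: D_def[abs_def])
  qed
  interpret switched_martingale_differences M F D W
  proof unfold_locales
    show "D k \<in> borel_measurable (F (Suc k))" for k
      using X_F[of k] p_F_Suc[of k] unfolding D_def W_def by measurable
  qed (use sub mono W_F D_le_W cond_exp_D in \<open>auto simp: W_def indicator_def\<close>)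
  have N_eq: "bin_count I p n \<omega> = N n \<omega>" for n \<omega>
    by (simp add: bin_count_def bin_hit_def N_def W_def sum.atLeast1_atMost_eq)
  have S_eq: "(\<Sum>t=1..n. bin_hit I p t \<omega> * (X t \<omega> - p (t - 1) \<omega>)) = S n \<omega>" for n \<omega>
    by (simp add: bin_hit_def S_def D_def W_def sum.atLeast1_atMost_eq)
  have diff_eq: "bin_mean_outcome I p X n \<omega> - bin_mean_forecast I p n \<omega> = S n \<omega> / N n \<omega>" for n \<omega>
    unfolding bin_mean_outcome_def bin_mean_forecast_def N_eq S_eq[symmetric]
    by (simp add: right_diff_distrib sum_subtractf diff_divide_distrib)
  have [measurable]: "S n \<in> borel_measurable M" "N n \<in> borel_measurable M" for n
    unfolding S_def[abs_def] N_def[abs_def] by measurable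
  \<comment> \<open>Integer thresholds suffice for divergence, which makes it a measurable event.\<close>
  have N_lim: "filterlim (\<lambda>n. N n \<omega>) at_top sequentially \<longleftrightarrow>
      (\<forall>z::nat. \<exists>n0. \<forall>n\<ge>n0. real z \<le> N n \<omega>)" for \<omega>
    unfolding filterlim_at_top eventually_sequentially
    by (meson order_trans real_arch_simple)
  let ?B = "{\<omega> \<in> space M. \<not> (filterlim (\<lambda>n. N n \<omega>) at_top sequentially \<longrightarrow>
    (\<lambda>n. S n \<omega> / N n \<omega>) \<longlonglongrightarrow> 0)}"
  have "?B \<in> sets M" unfolding N_lim by measurable
  with strong_law_on_random_clock have "?B \<in> null_sets M"
    by (subst (asm) AE_iff_null) auto
  moreover have "?B = {\<omega> \<in> space M. filterlim (\<lambda>n. bin_count I p n \<omega>) at_top sequentially} \<inter>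
      {\<omega> \<in> space M. \<not> (\<lambda>n. bin_mean_outcome I p X n \<omega> - bin_mean_forecast I p n \<omega>) \<longlonglongrightarrow> 0}"
    unfolding diff_eq N_eq by auto
  ultimately show ?thesis
    by (simp only: diff_eq S_eq N_eq bin_count_def[symmetric]) simp
qed

end
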